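(* Let $r,n$ be positive integers with $r\equiv2\pmod4$ and let $\pi\in A_{r,n}$. Then $$\ell_F(\pi)=2\sum_{\{i\,:\,z_i(\pi)=\frac r2\}}(i-1)-2\,\mathrm{tinv}(\pi).$$
   Context: For positive integers $m,n$, $G_{m,n}=\mathbb{Z}_m\wr S_n$ is the set of pairs $(\vec z,\tau)$ with $\vec z=(z_1,\dots,z_n)\in\{0,\dots,m-1\}^n$, $\tau\in S_n$, with product $(\vec z,\tau)(\vec z',\tau')=((z_1+z'_{\tau^{-1}(1)},\dots,z_n+z'_{\tau^{-1}(n)}),\tau\circ\tau')$, addition mod $m$. For $\pi=(\vec z,\tau)$: $z_i(\pi)=z_i$ is the color of the digit $i$; $|\pi|=(\vec0,\tau)$ is identified with $\tau$; $c_i(\pi)=z_{\tau(i)}$ is the color of the digit in place $i$; the window notation is $\pi=(\tau(1)^{[c_1]}\cdots\tau(n)^{[c_n]})$. The generator $s_0$ is the pair with vector $(1,0,\dots,0)$ and identity permutation; for $1\le i\le n-1$, $s_i$ is the pair with zero vector and transposition $(i\ i+1)$. $A_{r,n}$ is the kernel of the homomorphism $G_{r,n}\to\{\pm1\}$ sending every $s_i$, $0\le i\le n-1$, to $-1$. Put $a_0=s_0^2$, $a_i=s_0^{r/2}s_i$ for $1\le i\le n-1$, and $\mathcal A=\{a_0,a_1,a_1^{-1},a_2,\dots,a_{n-1}\}$, a generating set of $A_{r,n}$; $\ell_{\mathcal A}(\pi)$ is the minimal $u$ such that $\pi$ is a product of $u$ elements of $\mathcal A$. For a nonnegative integer $a$,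 $a\oslash 2\in\{0,\dots,\frac r2-1\}$ is the residue modulo $\frac r2$ of $\frac a2$ if $a$ is even, and of $\frac{a+r/2}{2}$ if $a$ is odd. The covering map $p:A_{r,n}\to G_{\frac r2,n}$ is $p((b_1^{[c_1]}\cdots b_n^{[c_n]}))=(b_1^{[c_1\oslash2]}\cdots b_n^{[c_n\oslash2]})$. Its section $s:G_{\frac r2,n}\to A_{r,n}$ is defined as follows: for $\pi=(p_1^{[c_1]}\cdots p_n^{[c_n]})$ with $p_j=1$, $s(\pi)=(p_1^{[2c_1]}\cdots p_n^{[2c_n]})$ if the usual inversion number $\mathrm{inv}(|\pi|)$ is even, and if $\mathrm{inv}(|\pi|)$ is odd, $s(\pi)$ is the same except that the color of $p_j=1$ is $2c_j+\frac r2$ (colors computed mod $r$). For $\pi\in A_{r,n}$ the fibral length is $\ell_F(\pi)=\ell_{\mathcal A}(\pi)-\ell_{\mathcal A}(s(p(\pi)))$. For $\pi\in A_{r,n}$, $\mathrm{Tinv}(\pi)=\{(i,j): z_i(\pi)=\frac r2,\ i>j,\ |\pi|^{-1}(i)<|\pi|^{-1}(j)\}$ and $\mathrm{tinv}(\pi)=|\mathrm{Tinv}(\pi)|$. *)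

theory Defs
  imports "HOL-Algebra.Sym_Groups"
begin

text \<open>
  A colored permutation is a pair of a color vector and a permutation of \<open>{1..n}\<close>.
  The color vector is indexed by digits: it is a function on \<open>{1..n}\<close>, made extensional so
  that equal vectors are equal functions.
\<close>

type_synonym colored_perm = "(nat \<Rightarrow> nat) \<times> (nat \<Rightarrow> nat)"

definition colored_group :: "nat \<Rightarrow> nat \<Rightarrow> colored_perm monoid" where
  "colored_group m n =
    \<lparr> carrier = ({1..n} \<rightarrow>\<^sub>E {0..<m}) \<times> carrier (sym_group n),
      mult = (\<lambda>(z, \<tau>) (z', \<tau>'). ((\<lambda>i\<in>{1..n}. (z i + z' (inv' \<tau> i)) mod m), \<tau> \<circ> \<tau>')),
      one = ((\<lambda>i\<in>{1..n}. 0), id) \<rparr>"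

definition digit_color :: "colored_perm \<Rightarrow> nat \<Rightarrow> nat" where
  "digit_color \<pi> i = fst \<pi> i"

definition abs_perm :: "colored_perm \<Rightarrow> (nat \<Rightarrow> nat)" where
  "abs_perm \<pi> = snd \<pi>"

definition place_color :: "colored_perm \<Rightarrow> nat \<Rightarrow> nat" where
  "place_color \<pi> i = digit_color \<pi> (abs_perm \<pi> i)"

text \<open>
  \<open>window n \<tau> c\<close> is the colored permutation with window notation
  \<open>(\<tau>(1)^[c 1] \<dots> \<tau>(n)^[c n])\<close>; the colors are given by place, so the digit \<open>d\<close> gets
  the color of the place \<open>\<tau>\<inverse>(d)\<close>.
\<close>

definition window :: "nat \<Rightarrow> (nat \<Rightarrow> nat) \<Rightarrow> (nat \<Rightarrow> nat) \<Rightarrow> colored_perm" where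
  "window n \<tau> c = ((\<lambda>d\<in>{1..n}. c (inv' \<tau> d)), \<tau>)"

definition s_gen :: "nat \<Rightarrow> nat \<Rightarrow> nat \<Rightarrow> colored_perm" where
  "s_gen m n i =
    (if i = 0 then ((\<lambda>d\<in>{1..n}. if d = 1 then 1 mod m else 0), id)
     else ((\<lambda>d\<in>{1..n}. 0), Transposition.transpose i (i + 1)))"

text \<open>
  For even \<open>r\<close> there is exactly one homomorphism to \<open>{-1, 1}\<close> sending all generators to \<open>-1\<close>;
  extensionality fixes its values outside the carrier, as the definite description needs.
\<close>

definition sign_hom :: "nat \<Rightarrow> nat \<Rightarrow> colored_perm \<Rightarrow> int" where
  "sign_hom r n =
    (THE \<phi>. \<phi> \<in> hom (colored_group r n) sign_img \<and>
            \<phi> \<in> extensional (carrier (colored_group r n)) \<and>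
            (\<forall>i<n. \<phi> (s_gen r n i) = -1))"

definition alt_colored :: "nat \<Rightarrow> nat \<Rightarrow> colored_perm set" where
  "alt_colored r n = kernel (colored_group r n) sign_img (sign_hom r n)"

definition a_gen :: "nat \<Rightarrow> nat \<Rightarrow> nat \<Rightarrow> colored_perm" where
  "a_gen r n i =
    (if i = 0 then s_gen r n 0 [^]\<^bsub>colored_group r n\<^esub> (2::nat)
     else (s_gen r n 0 [^]\<^bsub>colored_group r n\<^esub> (r div 2)) \<otimes>\<^bsub>colored_group r n\<^esub> s_gen r n i)"

text \<open>For \<open>n = 1\<close> there is no \<open>a\<^sub>1\<close>, and the only generator is \<open>a\<^sub>0\<close>.\<close>

definition a_gens :: "nat \<Rightarrow> nat \<Rightarrow> colored_perm set" where
  "a_gens r n =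
    a_gen r n ` {0..<n} \<union> (if 1 < n then {inv\<^bsub>colored_group r n\<^esub> (a_gen r n 1)} else {})"

definition a_length :: "nat \<Rightarrow> nat \<Rightarrow> colored_perm \<Rightarrow> nat" where
  "a_length r n \<pi> =
    (LEAST u. \<exists>ws. length ws = u \<and> set ws \<subseteq> a_gens r n \<and>
       foldr (\<lambda>x y. x \<otimes>\<^bsub>colored_group r n\<^esub> y) ws \<one>\<^bsub>colored_group r n\<^esub> = \<pi>)"

definition half_color :: "nat \<Rightarrow> nat \<Rightarrow> nat" where
  "half_color r a =
    (if even a then a div 2 else (a + r div 2) div 2) mod (r div 2)"

definition covering :: "nat \<Rightarrow> nat \<Rightarrow> colored_perm \<Rightarrow> colored_perm" where
  "covering r n \<pi> = window n (abs_perm \<pi>) (\<lambda>i. half_color r (place_color \<pi> i))"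

definition inversion_number :: "nat \<Rightarrow> (nat \<Rightarrow> nat) \<Rightarrow> nat" where
  "inversion_number n \<tau> =
    card {(i, j). i \<in> {1..n} \<and> j \<in> {1..n} \<and> i < j \<and> \<tau> i > \<tau> j}"

definition covering_section :: "nat \<Rightarrow> nat \<Rightarrow> colored_perm \<Rightarrow> colored_perm" where
  "covering_section r n \<pi> =
    window n (abs_perm \<pi>)
      (\<lambda>i. (if odd (inversion_number n (abs_perm \<pi>)) \<and> abs_perm \<pi> i = 1
            then 2 * place_color \<pi> i + r div 2
            else 2 * place_color \<pi> i) mod r)"

definition fibral_length :: "nat \<Rightarrow> nat \<Rightarrow> colored_perm \<Rightarrow> int" where
  "fibral_length r n \<pi> =
    int (a_length r n \<pi>) - int (a_length r n (covering_section r n (covering r n \<pi>)))"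

definition Tinv :: "nat \<Rightarrow> nat \<Rightarrow> colored_perm \<Rightarrow> (nat \<times> nat) set" where
  "Tinv r n \<pi> =
    {(i, j). i \<in> {1..n} \<and> j \<in> {1..n} \<and> digit_color \<pi> i = r div 2 \<and> i > j \<and>
             inv' (abs_perm \<pi>) i < inv' (abs_perm \<pi>) j}"

definition tinv :: "nat \<Rightarrow> nat \<Rightarrow> colored_perm \<Rightarrow> nat" where
  "tinv r n \<pi> = card (Tinv r n \<pi>)"

end

(* Every element of A_{r,n} is a pair of a color vector z and a permutation, and its length is
     sum_i (half color of z_i) + sum_{j < i} cost(i, j),
   where the pair of digits j < i costs 1 if i stands before j, and otherwise 2 or 0 according to
   whether z_i is nonzero. Left multiplication by a_0 raises the half color of the digit 1 by one
   modulo r/2. Left multiplication by a_k exchanges the digits k and k+1, and besides this only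
   changes the color of the digit 1 (or, for a_1^{-1}, of the digit 2) by r/2; this affects the cost
   of the pair (k+1, k) alone, and by exactly one. Conversely, an even element that admits
   no descent has increasing places, colors 0 at all digits above 1, and z_1 in {0, r/2}; parity
   then forces z_1 = 0. The section keeps the half colors and only kills the colors z_i = r/2 of the
   digits i > 1, so the fibral length counts twice the pairs j < i with z_i = r/2 and j before i. *)

theory Submission
  imports Defs
begin

section \<open>Colored permutation groups\<close>

lemma colored_carrier_iff:
  "(z, \<tau>) \<in> carrier (colored_group m n) \<longleftrightarrow>
    z \<in> {1..n} \<rightarrow>\<^sub>E {0..<m} \<and> \<tau> permutes {1..n}"
  by (simp add: colored_group_def sym_group_def)

lemma colored_mult:
  "(z, \<tau>) \<otimes>\<^bsub>colored_group m n\<^esub> (z', \<tau>') =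
    ((\<lambda>i\<in>{1..n}. (z i + z' (inv' \<tau> i)) mod m), \<tau> \<circ> \<tau>')"
  by (simp add: colored_group_def)

lemma colored_one: "\<one>\<^bsub>colored_group m n\<^esub> = ((\<lambda>i\<in>{1..n}. 0), id)"
  by (simp add: colored_group_def)

lemma colored_group_is_group:
  assumes "m > 0"
  shows "group (colored_group m n)"
proof (rule groupI)
  let ?G = "colored_group m n"
  fix x y w assume "x \<in> carrier ?G" "y \<in> carrier ?G" "w \<in> carrier ?G"
  moreover obtain a \<rho> b \<sigma> c \<tau> where xyw: "x = (a, \<rho>)" "y = (b, \<sigma>)" "w = (c, \<tau>)"
    by (metis surj_pair)
  ultimately have p: "\<rho> permutes {1..n}" "\<sigma> permutes {1..n}" "\<tau> permutes {1..n}"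
    by (auto simp: colored_carrier_iff)
  have inv: "inv' (\<rho> \<circ> \<sigma>) = inv' \<sigma> \<circ> inv' \<rho>"
    using p by (intro o_inv_distrib) (auto dest: permutes_bij)
  have mem: "inv' \<rho> i \<in> {1..n}" if "i \<in> {1..n}" for i
    using p(1) permutes_in_image permutes_inv that by metis
  show "(x \<otimes>\<^bsub>?G\<^esub> y) \<otimes>\<^bsub>?G\<^esub> w = x \<otimes>\<^bsub>?G\<^esub> (y \<otimes>\<^bsub>?G\<^esub> w)"
    using mem by (auto simp: xyw colored_mult inv comp_assoc mod_simps add.assoc restrict_def fun_eq_iff)
next
  let ?G = "colored_group m n"
  fix x y assume "x \<in> carrier ?G" "y \<in> carrier ?G"
  then show "x \<otimes>\<^bsub>?G\<^esub> y \<in> carrier ?G"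
    using assms by (cases x; cases y)
      (auto simp: colored_carrier_iff colored_mult intro: permutes_compose)
next
  let ?G = "colored_group m n"
  show "\<one>\<^bsub>?G\<^esub> \<in> carrier ?G"
    using assms by (auto simp: colored_one colored_carrier_iff permutes_id)
next
  let ?G = "colored_group m n"
  fix x assume "x \<in> carrier ?G"
  then obtain z \<tau> where x: "x = (z, \<tau>)" and z: "z \<in> {1..n} \<rightarrow>\<^sub>E {0..<m}"
    and \<tau>: "\<tau> permutes {1..n}"
    by (metis colored_carrier_iff surj_pair)
  have "z i mod m = z i" if "i \<in> {1..n}" for i
    using PiE_mem[OF z that] by simp
  moreover have "z i = undefined" if "i \<notin> {1..n}" for i
    using PiE_arb[OF z that] .
  ultimately show "\<one>\<^bsub>?G\<^esub> \<otimes>\<^bsub>?G\<^esub> x = x"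
    by (auto simp: x colored_one colored_mult restrict_def fun_eq_iff)
  \<comment> \<open>In the product \<open>?y\<close> times \<open>x\<close>, digit \<open>i\<close>
    receives the color of \<open>x\<close> at the digit \<open>\<tau> i\<close>, so that is the
    color to cancel; the outer \<open>mod\<close> covers color 0.\<close>
  let ?y = "((\<lambda>i\<in>{1..n}. (m - z (\<tau> i)) mod m), inv' \<tau>)"
  have "?y \<in> carrier ?G"
    using assms \<tau> by (auto simp: colored_carrier_iff permutes_inv)
  moreover have "((m - z i) mod m + z i) mod m = 0" if "i \<in> {1..n}" for i
  proof -
    have "z i < m" using z that by auto
    then show ?thesis by (simp add: mod_simps)
  qed
  then have "?y \<otimes>\<^bsub>?G\<^esub> x = \<one>\<^bsub>?G\<^esub>"
    using \<tau> permutes_in_image[OF \<tau>]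
    by (simp add: x colored_one colored_mult permutes_inv_inv permutes_inv_o restrict_def fun_eq_iff)
  ultimately show "\<exists>y\<in>carrier ?G. y \<otimes>\<^bsub>?G\<^esub> x = \<one>\<^bsub>?G\<^esub>"
    by blast
qed

lemma s_gen_0_pow:
  assumes "m > 0"
  shows "s_gen m n 0 [^]\<^bsub>colored_group m n\<^esub> (k::nat) =
    ((\<lambda>d\<in>{1..n}. if d = 1 then k mod m else 0), id)"
proof (induction k)
  case 0
  then show ?case by (simp add: nat_pow_def colored_one restrict_def fun_eq_iff)
next
  case (Suc k)
  have "s_gen m n 0 [^]\<^bsub>colored_group m n\<^esub> Suc k =
      s_gen m n 0 [^]\<^bsub>colored_group m n\<^esub> k \<otimes>\<^bsub>colored_group m n\<^esub> s_gen m n 0"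
    by (simp add: nat_pow_def)
  then show ?case
    unfolding Suc by (simp add: colored_mult s_gen_def restrict_def fun_eq_iff mod_simps)
qed

section \<open>Inversions counted by digits\<close>

text \<open>Pairs are indexed by digits, larger digit first, because left multiplication by a
  generator relabels digits and leaves places fixed.\<close>

definition digit_pairs :: "nat \<Rightarrow> (nat \<times> nat) set" where
  "digit_pairs n = (SIGMA i:{1..n}. {1..<i})"

lemma finite_digit_pairs [simp]: "finite (digit_pairs n)"
  by (simp add: digit_pairs_def)

text \<open>Applying \<open>\<tau>\<close> to both places of an inversion gives a larger digit that
  stands before a smaller one.\<close>

lemma inversion_number_eq_sum:
  assumes "\<tau> permutes {1..n}"
  shows "inversion_number n \<tau> =
    (\<Sum>(i, j)\<in>digit_pairs n. if inv' \<tau> i < inv' \<tau> j then 1 else 0)"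
proof -
  have mem: "\<tau> i \<in> {1..n} \<longleftrightarrow> i \<in> {1..n}" for i
    using permutes_in_image[OF assms] .
  have mem': "inv' \<tau> i \<in> {1..n} \<longleftrightarrow> i \<in> {1..n}" for i
    using permutes_in_image[OF permutes_inv[OF assms]] .
  have "inversion_number n \<tau> = card {(i, j) \<in> digit_pairs n. inv' \<tau> i < inv' \<tau> j}"
    unfolding inversion_number_def
  proof (rule bij_betw_same_card, rule bij_betw_byWitness)
    let ?f = "\<lambda>(a, b). (\<tau> a, \<tau> b)" and ?g = "\<lambda>(i, j). (inv' \<tau> i, inv' \<tau> j)"
    let ?A = "{(i, j). i \<in> {1..n} \<and> j \<in> {1..n} \<and> i < j \<and> \<tau> i > \<tau> j}"
    let ?B = "{(i, j) \<in> digit_pairs n. inv' \<tau> i < inv' \<tau> j}"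
    show "\<forall>p\<in>?A. ?g (?f p) = p" "\<forall>p\<in>?B. ?f (?g p) = p"
      using permutes_inverses[OF assms] by auto
    show "?f ` ?A \<subseteq> ?B"
      using permutes_inverses[OF assms] mem by (fastforce simp: digit_pairs_def)
    show "?g ` ?B \<subseteq> ?A"
      using permutes_inverses[OF assms] mem' by (fastforce simp: digit_pairs_def)
  qed
  also have "\<dots> = (\<Sum>(i, j)\<in>digit_pairs n. if inv' \<tau> i < inv' \<tau> j then 1 else 0)"
    by (simp add: sum.If_cases case_prod_unfold Int_def)
  finally show ?thesis .
qed

text \<open>No digit lies between \<open>k\<close> and \<open>k + 1\<close>, so exchanging them
  keeps the order in every pair except \<open>(k + 1, k)\<close>. That exchange permutes the
  remaining pairs, and only the terms at \<open>(k + 1, k)\<close> are left to compare. The additive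
  form avoids subtraction.\<close>

lemma sum_digit_pairs_transpose:
  fixes f g :: "nat \<Rightarrow> nat \<Rightarrow> 'a :: comm_monoid_add"
  assumes k: "1 \<le> k" "k < n"
    and fg: "\<And>i j. \<lbrakk>(i, j) \<in> digit_pairs n; (i, j) \<noteq> (k + 1, k)\<rbrakk> \<Longrightarrow>
      g i j = f (Transposition.transpose k (k + 1) i) (Transposition.transpose k (k + 1) j)"
  shows "(\<Sum>(i, j)\<in>digit_pairs n. g i j) + f (k + 1) k =
    (\<Sum>(i, j)\<in>digit_pairs n. f i j) + g (k + 1) k"
proof -
  let ?t = "Transposition.transpose k (k + 1)"
  let ?P = "digit_pairs n - {(k + 1, k)}"
  have kP: "(k + 1, k) \<in> digit_pairs n"
    using k by (auto simp: digit_pairs_def)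
  have "(\<Sum>(i, j)\<in>?P. g i j) = (\<Sum>(i, j)\<in>?P. f i j)"
  proof (rule sum.reindex_bij_witness[where i = "\<lambda>(i, j). (?t i, ?t j)" and j = "\<lambda>(i, j). (?t i, ?t j)"])
    fix p assume p: "p \<in> ?P"
    then show "(case (case p of (i, j) \<Rightarrow> (?t i, ?t j)) of (i, j) \<Rightarrow> f i j) =
      (case p of (i, j) \<Rightarrow> g i j)"
      using fg[of "fst p" "snd p"] by (auto simp: case_prod_unfold)
    show "(case p of (i, j) \<Rightarrow> (?t i, ?t j)) \<in> ?P"
      using p k by (auto simp: digit_pairs_def Transposition.transpose_def split: if_splits)
    then show "(case p of (i, j) \<Rightarrow> (?t i, ?t j)) \<in> ?P" .
  qed auto
  then show ?thesis
    by (simp add: sum.remove[OF _ kP] add_ac)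
qed


section \<open>The length function\<close>

text \<open>Here \<open>q\<close> is meant to be the inverse permutation, which sends a digit to its
  place.\<close>

definition pair_cost :: "(nat \<Rightarrow> nat) \<Rightarrow> (nat \<Rightarrow> nat) \<Rightarrow> nat \<Rightarrow> nat \<Rightarrow> nat" where
  "pair_cost z q i j = (if q i < q j then 1 else if z i = 0 then 0 else 2)"

definition len_formula :: "nat \<Rightarrow> nat \<Rightarrow> colored_perm \<Rightarrow> nat" where
  "len_formula r n \<pi> =
    (\<Sum>i\<in>{1..n}. half_color r (fst \<pi> i)) +
    (\<Sum>(i, j)\<in>digit_pairs n. pair_cost (fst \<pi>) (inv' (snd \<pi>)) i j)"

text \<open>A concrete substitute for the kernel of \<open>sign_hom\<close>;
  \<open>alt_colored_eq\<close> identifies the two on the carrier.\<close>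

definition even_colored :: "nat \<Rightarrow> colored_perm \<Rightarrow> bool" where
  "even_colored n \<pi> \<longleftrightarrow> even ((\<Sum>i\<in>{1..n}. fst \<pi> i) + inversion_number n (snd \<pi>))"

section \<open>Arithmetic of colors and half colors\<close>

lemma even_sum_mod_iff:
  fixes f :: "'a \<Rightarrow> nat"
  assumes "even m" "finite A"
  shows "even (\<Sum>i\<in>A. f i mod m) \<longleftrightarrow> even (\<Sum>i\<in>A. f i)"
  using assms by (simp add: even_sum_iff dvd_mod_iff)

text \<open>For odd \<open>h\<close> the number \<open>(h + 1) div 2\<close> is the inverse of 2
  modulo \<open>h\<close>. Both cases of the definition are thus division by 2 modulo
  \<open>h\<close>, and the further rules for half colors become modular arithmetic.\<close>

lemma half_color_eq:
  assumes "r = 2 * h" "odd h"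
  shows "half_color r a = a * ((h + 1) div 2) mod h"
proof -
  obtain k where h: "h = 2 * k + 1"
    using assms(2) by (elim oddE)
  show ?thesis
  proof (cases "even a")
    case True
    then obtain b where a: "a = 2 * b" by (elim evenE)
    have "a * ((h + 1) div 2) = b + h * b"
      by (simp add: a h algebra_simps)
    moreover have "half_color r a = b mod h"
      using assms by (simp add: half_color_def a)
    ultimately show ?thesis
      by (metis mod_mult_self2)
  next
    case False
    then obtain b where a: "a = 2 * b + 1" by (elim oddE)
    have "a * ((h + 1) div 2) = (b + k + 1) + h * b"
      by (simp add: a h algebra_simps)
    moreover have "(a + h) div 2 = b + k + 1"
      by (simp add: a h)
    ultimately have "half_color r a = (b + k + 1) mod h"
      using assms False by (simp add: half_color_def)
    then show ?thesis
      by (metis \<open>a * ((h + 1) div 2) = (b + k + 1) + h * b\<close> mod_mult_self2)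
  qed
qed

locale twice_odd =
  fixes r n h :: nat
  assumes r_eq: "r = 2 * h" and odd_h: "odd h" and n_pos: "0 < n"
begin

abbreviation G :: "colored_perm monoid" where
  "G \<equiv> colored_group r n"

lemma h_pos: "0 < h"
  using odd_h by (rule odd_pos)

lemma r_div_2: "r div 2 = h"
  by (simp add: r_eq)

lemma h_mod_r: "h mod r = h"
  using h_pos by (simp add: r_eq)

lemma h_add_h: "(h + h) mod r = 0"
  unfolding r_eq mult_2 by simp

lemma r_pos: "0 < r"
  using h_pos by (simp add: r_eq)

sublocale group G
  using r_pos by (rule colored_group_is_group)

lemma half_color_mod_r: "half_color r (a mod r) = half_color r a"
proof -
  have "(a mod r) mod h = a mod h"
    by (simp add: r_eq mod_mod_cancel)
  then show ?thesis
    unfolding half_color_eq[OF r_eq odd_h] by (metis mod_mult_left_eq)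
qed

lemma half_color_add_h: "half_color r (h + a) = half_color r a"
  by (simp add: half_color_eq[OF r_eq odd_h] distrib_right)

lemma half_color_add_2: "half_color r (2 + a) = (half_color r a + 1) mod h"
proof -
  have "(2 + a) * ((h + 1) div 2) = a * ((h + 1) div 2) + 1 + h"
    using odd_h by (auto elim!: oddE simp: algebra_simps)
  then show ?thesis
    unfolding half_color_eq[OF r_eq odd_h] by (simp only: mod_add_self2 mod_add_left_eq)
qed

lemma half_color_lt: "half_color r a < h"
  using h_pos by (simp add: half_color_def r_eq)

lemma half_color_0 [simp]: "half_color r 0 = 0"
  by (simp add: half_color_def)

lemma half_color_double: "half_color r (2 * b) = b mod h"
  by (simp add: half_color_def r_eq)

text \<open>The factor \<open>(h + 1) div 2\<close> is a unit modulo \<open>h\<close>, so the half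
  color vanishes exactly at multiples of \<open>h\<close>; below \<open>r = 2 * h\<close> these are
  0 and \<open>h\<close>.\<close>

lemma half_color_eq_0_iff:
  assumes "a < r"
  shows "half_color r a = 0 \<longleftrightarrow> a = 0 \<or> a = h"
proof -
  have "half_color r a = 0 \<longleftrightarrow> h dvd a * ((h + 1) div 2)"
    by (simp add: half_color_eq[OF r_eq odd_h] dvd_eq_mod_eq_0)
  also have "coprime h ((h + 1) div 2)"
  proof (rule coprimeI)
    fix d assume "d dvd h" "d dvd (h + 1) div 2"
    then have "d dvd h + 1"
      using odd_h by (metis dvd_mult_div_cancel dvd_mult even_Suc Suc_eq_plus1)
    then show "is_unit d"
      using \<open>d dvd h\<close> by (metis dvd_add_right_iff)
  qed
  then have "h dvd a * ((h + 1) div 2) \<longleftrightarrow> h dvd a"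
    by (rule coprime_dvd_mult_left_iff)
  also have "\<dots> \<longleftrightarrow> a = 0 \<or> a = h"
    using assms by (auto simp: r_eq elim!: dvdE)
  finally show ?thesis .
qed

section \<open>The generators in explicit form\<close>

text \<open>\<open>swap_gen 1 k\<close> is \<open>a\<^sub>k\<close>, and \<open>swap_gen 2 1\<close> is \<open>a\<^sub>1\<inverse>\<close>.\<close>

definition swap_gen :: "nat \<Rightarrow> nat \<Rightarrow> colored_perm" where
  "swap_gen c k =
    ((\<lambda>d\<in>{1..n}. if d = c then h else 0), Transposition.transpose k (k + 1))"

definition swap_index :: "nat \<Rightarrow> nat \<Rightarrow> bool" where
  "swap_index c k \<longleftrightarrow> 1 \<le> k \<and> k < n \<and> (c = 1 \<or> k = 1 \<and> c = 2)"

lemma transpose_permutes: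
  assumes "1 \<le> k" "k < n"
  shows "Transposition.transpose k (k + 1) permutes {1..n}"
  using assms by (intro permutes_swap_id) auto

lemma swap_gen_mult:
  "swap_gen c k \<otimes>\<^bsub>G\<^esub> (z, \<tau>) =
    ((\<lambda>i\<in>{1..n}. ((if i = c then h else 0) + z (Transposition.transpose k (k + 1) i)) mod r),
     Transposition.transpose k (k + 1) \<circ> \<tau>)"
  by (auto simp: swap_gen_def colored_mult fun_eq_iff inv_swap_id)

lemma swap_gen_carrier:
  assumes "1 \<le> k" "k < n"
  shows "swap_gen c k \<in> carrier G"
  using transpose_permutes[OF assms] h_pos
  by (auto simp: swap_gen_def colored_carrier_iff r_eq)

text \<open>The transposition moves the second color \<open>h\<close> onto digit \<open>c\<close>,
  where \<open>h + h\<close> vanishes modulo \<open>r\<close>. For \<open>c = 1\<close> and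
  \<open>k > 1\<close> this makes a_k an involution; for \<open>k = 1\<close> it pairs
  \<open>c = 1\<close> with \<open>c = 2\<close>.\<close>

lemma swap_gen_mult_inverse:
  assumes "1 \<le> k" "k < n"
  shows "swap_gen c k \<otimes>\<^bsub>G\<^esub> swap_gen (Transposition.transpose k (k + 1) c) k = \<one>\<^bsub>G\<^esub>"
proof -
  let ?t = "Transposition.transpose k (k + 1)"
  have mem: "?t i \<in> {1..n} \<longleftrightarrow> i \<in> {1..n}" for i
    using permutes_in_image[OF transpose_permutes[OF assms]] .
  have "?t i = ?t c \<longleftrightarrow> i = c" for i
    by (metis transpose_involutory)
  then show ?thesis
    using mem h_add_h
    by (subst (2) swap_gen_def) (auto simp: swap_gen_mult colored_one fun_eq_iff)
qed

lemma a_gen_0: "a_gen r n 0 = ((\<lambda>d\<in>{1..n}. if d = 1 then 2 mod r else 0), id)"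
  using r_pos by (simp add: a_gen_def s_gen_0_pow)

lemma a_gen_pos:
  assumes "1 \<le> k"
  shows "a_gen r n k = swap_gen 1 k"
proof -
  have "a_gen r n k = s_gen r n 0 [^]\<^bsub>G\<^esub> h \<otimes>\<^bsub>G\<^esub> s_gen r n k"
    using assms by (simp add: a_gen_def r_div_2)
  then show ?thesis
    using assms unfolding s_gen_0_pow[OF r_pos]
    by (auto simp: s_gen_def swap_gen_def colored_mult h_mod_r fun_eq_iff)
qed

lemma a_gen_0_carrier: "a_gen r n 0 \<in> carrier G"
  using r_pos by (auto simp: a_gen_0 colored_carrier_iff permutes_id)

lemma swap_gen_inverse:
  assumes "1 < n"
  shows "inv\<^bsub>G\<^esub> (swap_gen 1 1) = swap_gen 2 1"
  using swap_gen_mult_inverse[of 1 2] assms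
  by (intro inv_equality) (auto intro: swap_gen_carrier simp: numeral_2_eq_2)

lemma a_gens_eq:
  "a_gens r n = insert (a_gen r n 0) {swap_gen c k |c k. swap_index c k}"
proof -
  have "{0..<n} = insert 0 {1..<n}"
    using n_pos by auto
  moreover have "a_gen r n ` {1..<n} = swap_gen 1 ` {1..<n}"
    by (rule image_cong) (auto simp: a_gen_pos)
  ultimately have "a_gens r n = insert (a_gen r n 0)
      (swap_gen 1 ` {1..<n} \<union> (if 1 < n then {swap_gen 2 1} else {}))"
    unfolding a_gens_def a_gen_pos[OF order_refl]
    by (simp add: swap_gen_inverse[unfolded One_nat_def])
  also have "swap_gen 1 ` {1..<n} \<union> (if 1 < n then {swap_gen 2 1} else {}) =
      {swap_gen c k |c k. swap_index c k}"
    by (auto simp: swap_index_def) blast+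
  finally show ?thesis .
qed

lemma a_gens_carrier: "a_gens r n \<subseteq> carrier G"
  using a_gen_0_carrier swap_gen_carrier by (auto simp: a_gens_eq swap_index_def)

lemma a_gen_0_mult:
  assumes "(z, \<tau>) \<in> carrier G"
  shows "a_gen r n 0 \<otimes>\<^bsub>G\<^esub> (z, \<tau>) = (z(1 := (2 + z 1) mod r), \<tau>)"
proof -
  have z: "z \<in> {1..n} \<rightarrow>\<^sub>E {0..<r}"
    using assms by (simp add: colored_carrier_iff)
  have "z i mod r = z i" if "i \<in> {1..n}" for i
    using PiE_mem[OF z that] by simp
  moreover have "z i = undefined" if "i \<notin> {1..n}" for i
    using PiE_arb[OF z that] .
  ultimately show ?thesis
    using n_pos by (auto simp: a_gen_0 colored_mult fun_eq_iff mod_simps)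
qed

section \<open>Effect of the generators on the length formula\<close>

lemma inv_transpose_comp:
  assumes "\<tau> permutes {1..n}"
  shows "inv' (Transposition.transpose k (k + 1) \<circ> \<tau>) =
    inv' \<tau> \<circ> Transposition.transpose k (k + 1)"
  using assms by (subst o_inv_distrib) (auto dest: permutes_bij simp: inv_swap_id)

lemma inv_neq:
  assumes "\<tau> permutes {1..n}" "i \<noteq> j"
  shows "inv' \<tau> i \<noteq> inv' \<tau> j"
  using assms by (metis permutes_inverses(1))

text \<open>A shift by \<open>h\<close> is invisible to half colors, and what remains is a
  rearrangement of the summands.\<close>

lemma sum_half_color_swap:
  assumes "1 \<le> k" "k < n"
  shows "(\<Sum>i\<in>{1..n}. half_color r
      (((if i = c then h else 0) + z (Transposition.transpose k (k + 1) i)) mod r)) =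
    (\<Sum>i\<in>{1..n}. half_color r (z i))"
proof -
  let ?t = "Transposition.transpose k (k + 1)"
  have "half_color r (((if i = c then h else 0) + z (?t i)) mod r) = half_color r (z (?t i))" for i
    by (cases "i = c") (simp_all add: half_color_add_h half_color_mod_r)
  then show ?thesis
    using sum.permute[OF transpose_permutes[OF assms], of "\<lambda>i. half_color r (z i)"]
    by (simp add: o_def)
qed

text \<open>The last term is the cost of \<open>(k + 1, k)\<close> after the swap: the two places
  are exchanged, and digit \<open>k + 1\<close> carries the former color of \<open>k\<close>,
  shifted by \<open>h\<close> only in the case of the inverse of a_1. All other costs are
  permuted.\<close>

lemma len_formula_swap:
  assumes idx: "swap_index c k" and \<pi>: "(z, \<tau>) \<in> carrier G"
  shows "len_formula r n (swap_gen c k \<otimes>\<^bsub>G\<^esub> (z, \<tau>)) + pair_cost z (inv' \<tau>) (k + 1) k =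
    len_formula r n (z, \<tau>) +
    (if inv' \<tau> k < inv' \<tau> (k + 1) then 1
     else if ((if c = k + 1 then h else 0) + z k) mod r = 0 then 0 else 2)"
proof -
  let ?t = "Transposition.transpose k (k + 1)"
  let ?z = "\<lambda>i\<in>{1..n}. ((if i = c then h else 0) + z (?t i)) mod r"
  have k: "1 \<le> k" "k < n" and c: "c = 1 \<or> k = 1 \<and> c = 2"
    using idx by (auto simp: swap_index_def)
  have \<tau>: "\<tau> permutes {1..n}" and z: "z \<in> {1..n} \<rightarrow>\<^sub>E {0..<r}"
    using \<pi> by (auto simp: colored_carrier_iff)
  have "(\<Sum>(i, j)\<in>digit_pairs n. pair_cost ?z (inv' \<tau> \<circ> ?t) i j) + pair_cost z (inv' \<tau>) (k + 1) k =
    (\<Sum>(i, j)\<in>digit_pairs n. pair_cost z (inv' \<tau>) i j) + pair_cost ?z (inv' \<tau> \<circ> ?t) (k + 1) k"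
  proof (rule sum_digit_pairs_transpose[OF k])
    fix i j assume ij: "(i, j) \<in> digit_pairs n" "(i, j) \<noteq> (k + 1, k)"
    \<comment> \<open>The larger digit \<open>i\<close> is at least 2, so \<open>i = c\<close> would
      force \<open>c = 2\<close> and \<open>k = 1\<close>, hence the excluded pair
      \<open>(2, 1)\<close>.\<close>
    then have "i \<noteq> c" "i \<in> {1..n}"
      using c by (auto simp: digit_pairs_def)
    moreover have "z (?t i) < r"
      using PiE_mem[OF z, of "?t i"] permutes_in_image[OF transpose_permutes[OF k], of i] \<open>i \<in> {1..n}\<close>
      by auto
    ultimately show "pair_cost ?z (inv' \<tau> \<circ> ?t) i j = pair_cost z (inv' \<tau>) (?t i) (?t j)"
      by (simp add: pair_cost_def)
  qed
  moreover have "(\<Sum>i\<in>{1..n}. half_color r (?z i)) = (\<Sum>i\<in>{1..n}. half_color r (z i))"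
    using sum_half_color_swap[OF k, of c z] by simp
  moreover have "pair_cost ?z (inv' \<tau> \<circ> ?t) (k + 1) k =
    (if inv' \<tau> k < inv' \<tau> (k + 1) then 1
     else if ((if c = k + 1 then h else 0) + z k) mod r = 0 then 0 else 2)"
    using k by (auto simp: pair_cost_def)
  ultimately show ?thesis
    using inv_transpose_comp[OF \<tau>, of k] by (simp add: len_formula_def swap_gen_mult)
qed

text \<open>Digit 1 is never the larger digit of a pair, so its color enters no pair cost; only its
  own half color changes.\<close>

lemma len_formula_a_gen_0:
  assumes \<pi>: "(z, \<tau>) \<in> carrier G"
  shows "len_formula r n (a_gen r n 0 \<otimes>\<^bsub>G\<^esub> (z, \<tau>)) + half_color r (z 1) =
    len_formula r n (z, \<tau>) + (half_color r (z 1) + 1) mod h"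
proof -
  let ?z = "z(1 := (2 + z 1) mod r)"
  have "(\<Sum>(i, j)\<in>digit_pairs n. pair_cost ?z (inv' \<tau>) i j) =
      (\<Sum>(i, j)\<in>digit_pairs n. pair_cost z (inv' \<tau>) i j)"
    by (rule sum.cong) (auto simp: digit_pairs_def pair_cost_def)
  moreover have 1: "1 \<in> {1..n}" "finite {1..n}"
    using n_pos by auto
  have "(\<Sum>i\<in>{1..n} - {1}. half_color r (?z i)) = (\<Sum>i\<in>{1..n} - {1}. half_color r (z i))"
    by (rule sum.cong) auto
  then have "(\<Sum>i\<in>{1..n}. half_color r (?z i)) + half_color r (z 1) =
      (\<Sum>i\<in>{1..n}. half_color r (z i)) + (half_color r (z 1) + 1) mod h"
    unfolding sum.remove[OF 1(2,1)] by (simp only: half_color_add_2 half_color_mod_r fun_upd_same)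
  ultimately show ?thesis
    by (simp add: a_gen_0_mult[OF \<pi>] len_formula_def)
qed

text \<open>For a swap, exactly one of the old and new costs of \<open>(k + 1, k)\<close> is 1 and
  the other is 0 or 2, so the change is exactly one.\<close>

lemma len_formula_mult_le:
  assumes "g \<in> a_gens r n" "\<pi> \<in> carrier G"
  shows "len_formula r n (g \<otimes>\<^bsub>G\<^esub> \<pi>) \<le> len_formula r n \<pi> + 1"
proof -
  obtain z \<tau> where \<pi>: "\<pi> = (z, \<tau>)"
    by force
  then have z\<tau>: "(z, \<tau>) \<in> carrier G"
    using assms by simp
  from assms(1) consider "g = a_gen r n 0" | c k where "swap_index c k" "g = swap_gen c k"
    by (auto simp: a_gens_eq)
  then show ?thesis
  proof cases
    case 1
    have "(half_color r (z 1) + 1) mod h \<le> half_color r (z 1) + 1"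
      by (rule mod_less_eq_dividend)
    then show ?thesis
      using len_formula_a_gen_0[OF z\<tau>] unfolding 1 \<pi> by linarith
  next
    case 2
    have "\<tau> permutes {1..n}"
      using z\<tau> by (simp add: colored_carrier_iff)
    then have "inv' \<tau> k \<noteq> inv' \<tau> (k + 1)"
      by (rule inv_neq) simp
    then show ?thesis
      using len_formula_swap[OF 2(1) z\<tau>] unfolding 2(2) \<pi>
      by (auto simp: pair_cost_def split: if_splits)
  qed
qed

lemma len_formula_one: "len_formula r n \<one>\<^bsub>G\<^esub> = 0"
  by (auto simp: colored_one len_formula_def pair_cost_def digit_pairs_def)

text \<open>The lower bound for the length: the formula is 0 at the identity, and each letter adds
  at most one.\<close>

lemma word_len_formula:
  assumes "set ws \<subseteq> a_gens r n"
  shows "foldr (\<lambda>x y. x \<otimes>\<^bsub>G\<^esub> y) ws \<one>\<^bsub>G\<^esub> \<in> carrier G \<and>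
    len_formula r n (foldr (\<lambda>x y. x \<otimes>\<^bsub>G\<^esub> y) ws \<one>\<^bsub>G\<^esub>) \<le> length ws"
  using assms
proof (induction ws)
  case Nil
  then show ?case by (simp add: len_formula_one)
next
  case (Cons g ws)
  then have IH: "foldr (\<lambda>x y. x \<otimes>\<^bsub>G\<^esub> y) ws \<one>\<^bsub>G\<^esub> \<in> carrier G"
    "len_formula r n (foldr (\<lambda>x y. x \<otimes>\<^bsub>G\<^esub> y) ws \<one>\<^bsub>G\<^esub>) \<le> length ws"
    and g: "g \<in> a_gens r n" by auto
  then show ?case
    using len_formula_mult_le[OF g IH(1)] a_gens_carrier by auto
qed

section \<open>Parity\<close>

lemma s_gen_carrier:
  assumes "i < n"
  shows "s_gen r n i \<in> carrier G"
  using assms r_pos transpose_permutes[of i]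
  by (auto simp: s_gen_def colored_carrier_iff permutes_id)

text \<open>The generator s_0 adds 1 to the color sum, up to the even modulus \<open>r\<close>. Any
  other s_i permutes the colors and changes the inversion number by exactly one.\<close>

lemma even_colored_s_gen:
  assumes i: "i < n" and \<pi>: "\<pi> \<in> carrier G"
  shows "even_colored n (s_gen r n i \<otimes>\<^bsub>G\<^esub> \<pi>) \<longleftrightarrow> \<not> even_colored n \<pi>"
proof -
  obtain z \<tau> where z\<tau>: "\<pi> = (z, \<tau>)"
    by force
  have \<tau>: "\<tau> permutes {1..n}"
    using \<pi> by (simp add: z\<tau> colored_carrier_iff)
  have r: "even r" "1 mod r = 1"
    using h_pos by (auto simp: r_eq)
  show ?thesis
  proof (cases "i = 0")
    case True
    have "s_gen r n i \<otimes>\<^bsub>G\<^esub> \<pi> = ((\<lambda>d\<in>{1..n}. ((if d = 1 then 1 else 0) + z d) mod r), \<tau>)"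
      using r by (auto simp: True s_gen_def z\<tau> colored_mult fun_eq_iff)
    moreover have "(\<Sum>d\<in>{1..n}. (if d = 1 then 1 else 0) + z d) = 1 + (\<Sum>d\<in>{1..n}. z d)"
      using n_pos by (simp add: sum.distrib)
    ultimately show ?thesis
      using even_sum_mod_iff[OF r(1), of "{1..n}" "\<lambda>d. (if d = 1 then 1 else 0) + z d"]
      by (auto simp: even_colored_def z\<tau>)
  next
    case False
    let ?t = "Transposition.transpose i (i + 1)"
    have k: "1 \<le> i" "i < n"
      using False i by auto
    have mult: "s_gen r n i \<otimes>\<^bsub>G\<^esub> \<pi> = ((\<lambda>d\<in>{1..n}. z (?t d) mod r), ?t \<circ> \<tau>)"
      using False by (auto simp: s_gen_def z\<tau> colored_mult inv_swap_id fun_eq_iff)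
    have sum: "(\<Sum>d\<in>{1..n}. z (?t d)) = (\<Sum>d\<in>{1..n}. z d)"
      using sum.permute[OF transpose_permutes[OF k], of z] by (simp add: o_def)
    have inv: "inversion_number n (?t \<circ> \<tau>) + (if inv' \<tau> (i + 1) < inv' \<tau> i then 1 else 0) =
        inversion_number n \<tau> + (if inv' \<tau> i < inv' \<tau> (i + 1) then 1 else 0)"
    proof -
      let ?f = "\<lambda>d e. if inv' \<tau> d < inv' \<tau> e then 1 else (0::nat)"
      have "(\<Sum>(d, e)\<in>digit_pairs n. ?f (?t d) (?t e)) + ?f (i + 1) i =
          (\<Sum>(d, e)\<in>digit_pairs n. ?f d e) + ?f (?t (i + 1)) (?t i)"
        by (rule sum_digit_pairs_transpose[OF k]) simp
      then show ?thesis
        unfolding inversion_number_eq_sum[OF \<tau>] inv_transpose_comp[OF \<tau>]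
          inversion_number_eq_sum[OF permutes_compose[OF \<tau> transpose_permutes[OF k]]]
        by simp
    qed
    have "inv' \<tau> i \<noteq> inv' \<tau> (i + 1)"
      using \<tau> by (rule inv_neq) simp
    then have "inversion_number n (?t \<circ> \<tau>) = inversion_number n \<tau> + 1 \<or>
        inversion_number n \<tau> = inversion_number n (?t \<circ> \<tau>) + 1"
      using inv by (auto split: if_splits)
    then have parity: "even (inversion_number n (?t \<circ> \<tau>)) \<longleftrightarrow> odd (inversion_number n \<tau>)"
      by auto
    show ?thesis
      using even_sum_mod_iff[OF r(1), of "{1..n}" "\<lambda>d. z (?t d)"] sum parity mult
      by (auto simp: even_colored_def z\<tau>)
  qed
qed

lemma even_colored_s_gen_0_pow:
  assumes "\<pi> \<in> carrier G"
  shows "even_colored n (s_gen r n 0 [^]\<^bsub>G\<^esub> (k::nat) \<otimes>\<^bsub>G\<^esub> \<pi>) \<longleftrightarrow> (even k \<longleftrightarrow> even_colored n \<pi>)"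
  using assms
proof (induction k arbitrary: \<pi>)
  case 0
  then show ?case by simp
next
  case (Suc k)
  have s: "s_gen r n 0 \<in> carrier G"
    using n_pos by (rule s_gen_carrier)
  then have "s_gen r n 0 [^]\<^bsub>G\<^esub> Suc k \<otimes>\<^bsub>G\<^esub> \<pi> =
      s_gen r n 0 [^]\<^bsub>G\<^esub> k \<otimes>\<^bsub>G\<^esub> (s_gen r n 0 \<otimes>\<^bsub>G\<^esub> \<pi>)"
    using Suc.prems by (simp add: m_assoc)
  then show ?case
    using Suc s even_colored_s_gen[OF n_pos Suc.prems] by auto
qed

text \<open>Each a_i is a product of an even number of s-generators: two for a_0, and
  \<open>h + 1\<close> otherwise, with \<open>h\<close> odd.\<close>

lemma even_colored_a_gen:
  assumes "i < n" "\<pi> \<in> carrier G"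
  shows "even_colored n (a_gen r n i \<otimes>\<^bsub>G\<^esub> \<pi>) \<longleftrightarrow> even_colored n \<pi>"
proof (cases "i = 0")
  case True
  then show ?thesis
    using even_colored_s_gen_0_pow[OF assms(2), of 2] by (simp add: a_gen_def)
next
  case False
  have s: "s_gen r n 0 \<in> carrier G" "s_gen r n i \<in> carrier G"
    using n_pos assms(1) by (auto intro: s_gen_carrier)
  then have "a_gen r n i \<otimes>\<^bsub>G\<^esub> \<pi> = s_gen r n 0 [^]\<^bsub>G\<^esub> h \<otimes>\<^bsub>G\<^esub> (s_gen r n i \<otimes>\<^bsub>G\<^esub> \<pi>)"
    using False assms(2) by (simp add: a_gen_def r_div_2 m_assoc)
  then show ?thesis
    using s assms odd_h by (simp add: even_colored_s_gen_0_pow even_colored_s_gen)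
qed

lemma a_gen_carrier:
  assumes "i < n"
  shows "a_gen r n i \<in> carrier G"
  using assms a_gens_carrier by (auto simp: a_gens_def)

lemma even_colored_mult:
  assumes "g \<in> a_gens r n" "\<pi> \<in> carrier G"
  shows "even_colored n (g \<otimes>\<^bsub>G\<^esub> \<pi>) \<longleftrightarrow> even_colored n \<pi>"
proof -
  from assms(1) consider i where "i < n" "g = a_gen r n i"
    | "1 < n" "g = inv\<^bsub>G\<^esub> (a_gen r n 1)"
    by (auto simp: a_gens_def split: if_splits)
  then show ?thesis
  proof cases
    case 1
    then show ?thesis using assms(2) by (simp add: even_colored_a_gen)
  next
    case 2
    then have a: "a_gen r n 1 \<in> carrier G"
      by (intro a_gen_carrier)
    then have "a_gen r n 1 \<otimes>\<^bsub>G\<^esub> (g \<otimes>\<^bsub>G\<^esub> \<pi>) = \<pi>"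
      using assms(2) unfolding 2(2) by (simp add: m_assoc[symmetric])
    then show ?thesis
      using even_colored_a_gen[OF 2(1), of "g \<otimes>\<^bsub>G\<^esub> \<pi>"] a assms(2) 2(2) by simp
  qed
qed

section \<open>Descents\<close>

lemma descent_a_gen_0:
  assumes \<pi>: "(z, \<tau>) \<in> carrier G" and z1: "half_color r (z 1) \<noteq> 0"
  shows "\<exists>\<pi>'\<in>carrier G. (z, \<tau>) = a_gen r n 0 \<otimes>\<^bsub>G\<^esub> \<pi>' \<and>
    len_formula r n (z, \<tau>) = len_formula r n \<pi>' + 1"
proof -
  have z: "z \<in> {1..n} \<rightarrow>\<^sub>E {0..<r}"
    using \<pi> by (simp add: colored_carrier_iff)
  have 1: "1 \<in> {1..n}"
    using n_pos by simp
  have z1r: "z 1 < r"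
    using PiE_mem[OF z 1] by simp
  have r2: "2 \<le> r"
    using h_pos by (simp add: r_eq)
  \<comment> \<open>Adding \<open>r - 2\<close> undoes a_0, which adds 2 to the color of digit 1
    modulo \<open>r\<close>.\<close>
  let ?z = "z(1 := (z 1 + (r - 2)) mod r)"
  have \<pi>': "(?z, \<tau>) \<in> carrier G"
    using \<pi> r_pos 1 by (auto simp: colored_carrier_iff PiE_iff extensional_def)
  have "(2 + ?z 1) mod r = z 1"
  proof -
    have "(2 + ?z 1) mod r = (2 + (z 1 + (r - 2))) mod r"
      by (simp only: fun_upd_same mod_add_right_eq)
    also have "2 + (z 1 + (r - 2)) = z 1 + r"
      using r2 by simp
    finally show ?thesis
      using z1r by simp
  qed
  then have eq: "(z, \<tau>) = a_gen r n 0 \<otimes>\<^bsub>G\<^esub> (?z, \<tau>)"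
    unfolding a_gen_0_mult[OF \<pi>'] by (simp add: fun_eq_iff)
  have "half_color r (z 1) = (half_color r (?z 1) + 1) mod h"
    using \<open>(2 + ?z 1) mod r = z 1\<close> half_color_add_2[of "?z 1"] half_color_mod_r by metis
  \<comment> \<open>Otherwise the sum would be \<open>h\<close> and wrap around to 0, against
    \<open>z1\<close>.\<close>
  moreover from this have "half_color r (?z 1) + 1 < h"
    using half_color_lt[of "?z 1"] z1 by (metis Suc_eq_plus1 Suc_lessI mod_self)
  ultimately have "len_formula r n (z, \<tau>) = len_formula r n (?z, \<tau>) + 1"
    using len_formula_a_gen_0[OF \<pi>'] unfolding eq[symmetric] by simp
  then show ?thesis
    using \<pi>' eq by blast
qed

text \<open>The hypothesis says that the swap lowers the cost of \<open>(k + 1, k)\<close>. The drop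
  is exactly one, and the element is recovered by the inverse swap, which is again a
  generator.\<close>

lemma descent_swap:
  assumes \<pi>: "(z, \<tau>) \<in> carrier G" and idx: "swap_index c k"
    and less: "(if inv' \<tau> k < inv' \<tau> (k + 1) then 1
      else if ((if c = k + 1 then h else 0) + z k) mod r = 0 then 0 else 2)
      < pair_cost z (inv' \<tau>) (k + 1) k"
  shows "\<exists>g\<in>a_gens r n. \<exists>\<pi>'\<in>carrier G. (z, \<tau>) = g \<otimes>\<^bsub>G\<^esub> \<pi>' \<and>
    len_formula r n (z, \<tau>) = len_formula r n \<pi>' + 1"
proof -
  have k: "1 \<le> k" "k < n"
    using idx by (auto simp: swap_index_def)
  let ?c = "Transposition.transpose k (k + 1) c"
  let ?\<pi> = "swap_gen c k \<otimes>\<^bsub>G\<^esub> (z, \<tau>)"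
  have "swap_index ?c k"
    using idx by (auto simp: swap_index_def Transposition.transpose_def)
  then have "swap_gen ?c k \<in> a_gens r n"
    by (auto simp: a_gens_eq)
  moreover have "?\<pi> \<in> carrier G"
    using swap_gen_carrier[OF k] \<pi> by simp
  moreover have "swap_gen ?c k \<otimes>\<^bsub>G\<^esub> swap_gen c k = \<one>\<^bsub>G\<^esub>"
    using swap_gen_mult_inverse[OF k, of ?c] by simp
  then have "(z, \<tau>) = swap_gen ?c k \<otimes>\<^bsub>G\<^esub> ?\<pi>"
    using swap_gen_carrier[OF k] \<pi> by (simp add: m_assoc[symmetric])
  moreover have "len_formula r n (z, \<tau>) = len_formula r n ?\<pi> + 1"
  proof -
    have "\<tau> permutes {1..n}"
      using \<pi> by (simp add: colored_carrier_iff)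
    then have "inv' \<tau> k \<noteq> inv' \<tau> (k + 1)"
      by (rule inv_neq) simp
    then show ?thesis
      using len_formula_swap[OF idx \<pi>] less by (auto simp: pair_cost_def split: if_splits)
  qed
  ultimately show ?thesis
    by blast
qed

lemma exists_descent:
  assumes \<pi>: "\<pi> \<in> carrier G" and even: "even_colored n \<pi>" and not_one: "\<pi> \<noteq> \<one>\<^bsub>G\<^esub>"
  shows "\<exists>g\<in>a_gens r n. \<exists>\<pi>'\<in>carrier G. \<pi> = g \<otimes>\<^bsub>G\<^esub> \<pi>' \<and>
    len_formula r n \<pi> = len_formula r n \<pi>' + 1"
proof (rule ccontr)
  assume no: "\<not> ?thesis"
  obtain z \<tau> where z\<tau>: "\<pi> = (z, \<tau>)"
    by force
  then have z\<tau>_in: "(z, \<tau>) \<in> carrier G"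
    using \<pi> by simp
  then have \<tau>: "\<tau> permutes {1..n}" and z: "z \<in> {1..n} \<rightarrow>\<^sub>E {0..<r}"
    by (auto simp: colored_carrier_iff)
  have "a_gen r n 0 \<in> a_gens r n"
    by (simp add: a_gens_eq)
  then have "half_color r (z 1) = 0"
    using descent_a_gen_0[OF z\<tau>_in] no unfolding z\<tau> by blast
  then have z1: "z 1 = 0 \<or> z 1 = h"
    using half_color_eq_0_iff[of "z 1"] PiE_mem[OF z, of 1] n_pos by simp
  have no_swap: "pair_cost z (inv' \<tau>) (k + 1) k \<le> (if inv' \<tau> k < inv' \<tau> (k + 1) then 1
      else if ((if c = k + 1 then h else 0) + z k) mod r = 0 then 0 else 2)"
    if "swap_index c k" for c k
    using descent_swap[OF z\<tau>_in that] no unfolding z\<tau> by (meson not_le)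
  have neq: "inv' \<tau> k \<noteq> inv' \<tau> (k + 1)" for k
    using \<tau> by (rule inv_neq) simp
  \<comment> \<open>The swap is chosen so that digit \<open>k + 1\<close> gets color 0. If
    \<open>k + 1\<close> stood before \<open>k\<close>, the cost would drop from 1 to 0; so
    \<open>k\<close> comes first, and a nonzero color of \<open>k + 1\<close> would let it drop from
    2 to 1.\<close>
  have step: "inv' \<tau> k < inv' \<tau> (k + 1) \<and> z (k + 1) = 0" if "1 \<le> k" "k < n" for k
    using that
  proof (induction k rule: nat_induct_at_least)
    case base
    \<comment> \<open>Color 0 of digit 1 already passes to digit 2 as 0; color \<open>h\<close>
      needs the extra \<open>h\<close> at digit 2.\<close>
    define c where "c = (if z 1 = 0 then 1 else 2 :: nat)"
    have "swap_index c 1"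
      using base by (simp add: swap_index_def c_def)
    moreover have "((if c = 1 + 1 then h else 0) + z 1) mod r = 0"
      using z1 h_add_h by (auto simp: c_def)
    ultimately show ?case
      using no_swap[of c 1] neq[of 1] by (auto simp: pair_cost_def split: if_splits)
  next
    case (Suc k)
    have "swap_index 1 (Suc k)" "z (Suc k) = 0"
      using Suc by (auto simp: swap_index_def)
    then show ?case
      using no_swap[of 1 "Suc k"] neq[of "Suc k"] Suc.hyps
      by (auto simp: pair_cost_def split: if_splits)
  qed
  \<comment> \<open>The places increase strictly from at least 1, and a permutation of
    \<open>{1..n}\<close> that lowers no element is the identity.\<close>
  have ge: "i \<le> inv' \<tau> i" if "1 \<le> i" "i \<le> n" for i
    using that
  proof (induction i rule: nat_induct_at_least)
    case base
    then show ?case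
      using permutes_in_image[OF permutes_inv[OF \<tau>], of 1] by simp
  next
    case (Suc k)
    then show ?case
      using step[of k] by simp
  qed
  have "inv' \<tau> = id"
    by (rule permutes_natset_ge[OF permutes_inv[OF \<tau>]]) (use ge in auto)
  then have \<tau>_id: "\<tau> = id"
    using \<tau> by (metis inv_id permutes_inv_inv)
  have z0: "z i = 0" if "i \<in> {1..n}" "i \<noteq> 1" for i
    using step[of "i - 1"] that by auto
  have "(\<Sum>i\<in>{1..n}. z i) = (\<Sum>i\<in>{1..n}. if i = 1 then z 1 else 0)"
    by (rule sum.cong) (use z0 in auto)
  also have "\<dots> = z 1"
    using n_pos by simp
  finally have "(\<Sum>i\<in>{1..n}. z i) = z 1" .
  moreover have "inversion_number n id = 0"
    unfolding inversion_number_def by (rule card_eq_0_iff[THEN iffD2]) auto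
  ultimately have "even (z 1)"
    using even by (simp add: even_colored_def z\<tau> \<tau>_id)
  then have "z 1 = 0"
    using z1 odd_h by auto
  then have "z i = 0" if "i \<in> {1..n}" for i
    using z0 that by (cases "i = 1") auto
  then have "z = (\<lambda>i\<in>{1..n}. 0)"
    using PiE_arb[OF z] by (auto simp: fun_eq_iff restrict_def)
  then show False
    using not_one by (simp add: z\<tau> \<tau>_id colored_one)
qed

text \<open>Following descents down to the identity gives the upper bound for the length. It also
  shows that \<open>a_gens\<close> generates all even elements, on which the uniqueness of the sign
  character rests.\<close>

lemma exists_word:
  assumes "\<pi> \<in> carrier G" "even_colored n \<pi>"
  shows "\<exists>ws. length ws = len_formula r n \<pi> \<and> set ws \<subseteq> a_gens r n \<and>
    foldr (\<lambda>x y. x \<otimes>\<^bsub>G\<^esub> y) ws \<one>\<^bsub>G\<^esub> = \<pi>"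
  using assms
proof (induction "len_formula r n \<pi>" arbitrary: \<pi> rule: less_induct)
  case less
  show ?case
  proof (cases "\<pi> = \<one>\<^bsub>G\<^esub>")
    case True
    then show ?thesis
      by (intro exI[of _ "[]"]) (simp add: len_formula_one)
  next
    case False
    then obtain g \<pi>' where g: "g \<in> a_gens r n" and \<pi>': "\<pi>' \<in> carrier G"
      and eq: "\<pi> = g \<otimes>\<^bsub>G\<^esub> \<pi>'" and len: "len_formula r n \<pi> = len_formula r n \<pi>' + 1"
      using exists_descent less.prems by blast
    then have "even_colored n \<pi>'"
      using less.prems(2) even_colored_mult by blast
    then obtain ws where "length ws = len_formula r n \<pi>'" "set ws \<subseteq> a_gens r n"
      "foldr (\<lambda>x y. x \<otimes>\<^bsub>G\<^esub> y) ws \<one>\<^bsub>G\<^esub> = \<pi>'"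
      using less.hyps[of \<pi>'] len \<pi>' by auto
    then show ?thesis
      using g eq len by (intro exI[of _ "g # ws"]) simp
  qed
qed

lemma a_length_eq_len_formula:
  assumes "\<pi> \<in> carrier G" "even_colored n \<pi>"
  shows "a_length r n \<pi> = len_formula r n \<pi>"
  unfolding a_length_def
proof (rule Least_equality)
  show "\<exists>ws. length ws = len_formula r n \<pi> \<and> set ws \<subseteq> a_gens r n \<and>
      foldr (\<lambda>x y. x \<otimes>\<^bsub>G\<^esub> y) ws \<one>\<^bsub>G\<^esub> = \<pi>"
    using exists_word[OF assms] .
qed (use word_len_formula in blast)

section \<open>The sign character\<close>

lemma sign_img_pow: "x [^]\<^bsub>sign_img\<^esub> (k::nat) = x ^ k"
  by (induction k) (simp_all add: sign_img_def nat_pow_def mult.commute)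

text \<open>Such a character is 1 on every letter in \<open>a_gens\<close>, hence on all even
  elements by \<open>exists_word\<close>; an odd element becomes even after multiplication by s_0,
  whose value is -1.\<close>

lemma sign_character_eq:
  assumes hom: "\<phi> \<in> hom G sign_img" and gen: "\<And>i. i < n \<Longrightarrow> \<phi> (s_gen r n i) = -1"
    and \<pi>: "\<pi> \<in> carrier G"
  shows "\<phi> \<pi> = (if even_colored n \<pi> then 1 else -1)"
proof -
  interpret \<phi>: group_hom G sign_img \<phi>
    using hom by (intro group_hom.intro group_hom_axioms.intro sign_img_is_group) (rule is_group)
  have mult: "x \<otimes>\<^bsub>sign_img\<^esub> y = x * y" and one: "\<one>\<^bsub>sign_img\<^esub> = 1" for x y
    by (simp_all add: sign_img_def)
  have s: "s_gen r n i \<in> carrier G" if "i < n" for i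
    using that by (rule s_gen_carrier)
  have a: "\<phi> (a_gen r n i) = 1" if "i < n" for i
    using that s gen n_pos odd_h
    by (auto simp: a_gen_def \<phi>.hom_nat_pow sign_img_pow mult r_div_2)
  have "\<phi> g = 1" if "g \<in> a_gens r n" for g
  proof -
    from that consider i where "i < n" "g = a_gen r n i"
      | "1 < n" "g = inv\<^bsub>G\<^esub> (a_gen r n 1)"
      by (auto simp: a_gens_def split: if_splits)
    then show ?thesis
    proof cases
      case 2
      then show ?thesis
        using a[of 1] a_gen_carrier[of 1] \<phi>.H.inv_one by (simp add: one)
    qed (simp add: a)
  qed
  then have word: "\<phi> (foldr (\<lambda>x y. x \<otimes>\<^bsub>G\<^esub> y) ws \<one>\<^bsub>G\<^esub>) = 1" if "set ws \<subseteq> a_gens r n" for ws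
    using that
  proof (induction ws)
    case Nil
    then show ?case using \<phi>.hom_one by (simp add: one)
  next
    case (Cons g ws)
    then have "g \<in> a_gens r n" "g \<in> carrier G"
      "foldr (\<lambda>x y. x \<otimes>\<^bsub>G\<^esub> y) ws \<one>\<^bsub>G\<^esub> \<in> carrier G"
      using word_len_formula[of ws] a_gens_carrier by auto
    then show ?case
      using Cons by (simp add: mult)
  qed
  have even: "\<phi> x = 1" if "x \<in> carrier G" "even_colored n x" for x
    using exists_word[OF that] word by blast
  show ?thesis
  proof (cases "even_colored n \<pi>")
    case False
    then have "\<phi> (s_gen r n 0 \<otimes>\<^bsub>G\<^esub> \<pi>) = 1"
      using n_pos \<pi> s by (intro even) (simp_all add: even_colored_s_gen)
    then show ?thesis
      using False \<pi> s gen n_pos by (simp add: mult)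
  qed (simp add: even \<pi>)
qed

lemma sign_character_exists:
  "\<exists>\<phi>. \<phi> \<in> hom G sign_img \<and> \<phi> \<in> extensional (carrier G) \<and> (\<forall>i<n. \<phi> (s_gen r n i) = -1)"
proof -
  \<comment> \<open>The witness uses \<open>sign\<close>, which is multiplicative on permutations;
    the color factor is compatible with reduction modulo the even number \<open>r\<close>.\<close>
  define \<psi> :: "colored_perm \<Rightarrow> int" where
    "\<psi> x = (-1) ^ (\<Sum>i\<in>{1..n}. fst x i) * sign (snd x)" for x
  have r: "even r" "1 mod r = 1"
    using h_pos by (auto simp: r_eq)
  have "restrict \<psi> (carrier G) \<in> hom G sign_img"
  proof (rule homI)
    fix x assume "x \<in> carrier G"
    then show "restrict \<psi> (carrier G) x \<in> carrier sign_img"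
      by (auto simp: \<psi>_def sign_img_def sign_def minus_one_power_iff)
  next
    fix x y assume xy: "x \<in> carrier G" "y \<in> carrier G"
    obtain a \<sigma> b \<tau> where eqs: "x = (a, \<sigma>)" "y = (b, \<tau>)"
      by (metis surj_pair)
    then have p: "\<sigma> permutes {1..n}" "\<tau> permutes {1..n}"
      using xy by (auto simp: colored_carrier_iff)
    then have "sign (\<sigma> \<circ> \<tau>) = sign \<sigma> * sign \<tau>"
      by (intro sign_compose permutes_imp_permutation[of "{1..n}"]) auto
    moreover have "(\<Sum>i\<in>{1..n}. b (inv' \<sigma> i)) = (\<Sum>i\<in>{1..n}. b i)"
      using sum.permute[OF permutes_inv[OF p(1)], of b] by (simp add: o_def)
    then have "(-1 :: int) ^ (\<Sum>i\<in>{1..n}. (a i + b (inv' \<sigma> i)) mod r) =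
        (-1) ^ (\<Sum>i\<in>{1..n}. a i) * (-1) ^ (\<Sum>i\<in>{1..n}. b i)"
      using even_sum_mod_iff[OF r(1), of "{1..n}" "\<lambda>i. a i + b (inv' \<sigma> i)"]
      by (simp add: minus_one_power_iff sum.distrib)
    ultimately have "\<psi> (x \<otimes>\<^bsub>G\<^esub> y) = \<psi> x * \<psi> y"
      by (simp add: \<psi>_def eqs colored_mult)
    then show "restrict \<psi> (carrier G) (x \<otimes>\<^bsub>G\<^esub> y) =
        restrict \<psi> (carrier G) x \<otimes>\<^bsub>sign_img\<^esub> restrict \<psi> (carrier G) y"
      using xy by (simp add: sign_img_def)
  qed
  moreover have "restrict \<psi> (carrier G) (s_gen r n i) = -1" if "i < n" for i
  proof -
    have "\<psi> (s_gen r n i) = -1"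
      using that r by (auto simp: \<psi>_def s_gen_def sign_swap_id)
    then show ?thesis
      using s_gen_carrier[OF that] by simp
  qed
  ultimately show ?thesis
    by (intro exI[of _ "restrict \<psi> (carrier G)"]) simp
qed

text \<open>Existence and uniqueness of the character justify the definite description in
  \<open>sign_hom\<close>, so its kernel can be read off.\<close>

lemma alt_colored_eq: "alt_colored r n = {\<pi> \<in> carrier G. even_colored n \<pi>}"
proof -
  let ?P = "\<lambda>\<phi>. \<phi> \<in> hom G sign_img \<and> \<phi> \<in> extensional (carrier G) \<and>
    (\<forall>i<n. \<phi> (s_gen r n i) = -1)"
  have "\<exists>!\<phi>. ?P \<phi>"
  proof (rule ex_ex1I)
    show "\<exists>\<phi>. ?P \<phi>"
      by (rule sign_character_exists)
    fix \<phi> \<psi> assume "?P \<phi>" "?P \<psi>"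
    then show "\<phi> = \<psi>"
      by (intro extensionalityI[of _ "carrier G"]) (auto simp: sign_character_eq)
  qed
  then have "?P (sign_hom r n)"
    unfolding sign_hom_def by (rule theI')
  then have "sign_hom r n \<pi> = (if even_colored n \<pi> then 1 else -1)" if "\<pi> \<in> carrier G" for \<pi>
    using that by (intro sign_character_eq) auto
  then show ?thesis
    by (auto simp: alt_colored_def kernel_def sign_img_def split: if_splits)
qed

section \<open>The fibral length\<close>

lemma section_covering:
  "covering_section r n (covering r n (z, \<tau>)) =
    ((\<lambda>d\<in>{1..n}. ((if odd (inversion_number n \<tau>) \<and> d = 1 then h else 0) +
       2 * half_color r (z d)) mod r), \<tau>)"
  if "(z, \<tau>) \<in> carrier G"
proof -
  have \<tau>: "\<tau> permutes {1..n}"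
    using that by (simp add: colored_carrier_iff)
  show ?thesis
    by (auto simp: covering_section_def covering_def window_def abs_perm_def place_color_def
        digit_color_def r_div_2 permutes_inverses[OF \<tau>] fun_eq_iff add.commute)
qed

text \<open>Doubled colors contribute an even sum, and the odd correction \<open>h\<close> is
  present exactly when the inversion number is odd. So the length formula applies to the section as
  well.\<close>

lemma section_covering_in:
  assumes \<pi>: "\<pi> \<in> carrier G"
  shows "covering_section r n (covering r n \<pi>) \<in> carrier G"
    and "even_colored n (covering_section r n (covering r n \<pi>))"
proof -
  obtain z \<tau> where z\<tau>: "\<pi> = (z, \<tau>)"
    by force
  let ?c = "\<lambda>d. (if odd (inversion_number n \<tau>) \<and> d = 1 then h else 0) + 2 * half_color r (z d)"
  have eq: "covering_section r n (covering r n \<pi>) = ((\<lambda>d\<in>{1..n}. ?c d mod r), \<tau>)"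
    using section_covering \<pi> unfolding z\<tau> by simp
  show "covering_section r n (covering r n \<pi>) \<in> carrier G"
    using \<pi> r_pos unfolding eq by (auto simp: z\<tau> colored_carrier_iff)
  have "even r"
    by (simp add: r_eq)
  have "(\<Sum>d\<in>{1..n}. ?c d) = (if odd (inversion_number n \<tau>) then h else 0) +
      2 * (\<Sum>d\<in>{1..n}. half_color r (z d))"
    using n_pos by (auto simp: sum.distrib sum_distrib_left)
  then show "even_colored n (covering_section r n (covering r n \<pi>))"
    using even_sum_mod_iff[OF \<open>even r\<close>, of "{1..n}" ?c] odd_h
    unfolding eq even_colored_def by (auto split: if_splits)
qed

lemma tinv_eq_sum:
  "tinv r n (z, \<tau>) =
    (\<Sum>(i, j)\<in>digit_pairs n. if z i = h \<and> inv' \<tau> i < inv' \<tau> j then 1 else 0)"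
proof -
  have "Tinv r n (z, \<tau>) = {(i, j) \<in> digit_pairs n. z i = h \<and> inv' \<tau> i < inv' \<tau> j}"
    by (auto simp: Tinv_def digit_color_def abs_perm_def r_div_2 digit_pairs_def)
  then show ?thesis
    by (simp add: tinv_def sum.If_cases case_prod_unfold Int_def)
qed

text \<open>Digit \<open>i\<close> is the larger member of exactly \<open>i - 1\<close>
  pairs.\<close>

lemma sum_digits_eq_sum_pairs:
  "(\<Sum>i\<in>{i \<in> {1..n}. P i}. int i - 1) = (\<Sum>(i, j)\<in>digit_pairs n. if P i then 1 else 0)"
proof -
  have "(\<Sum>(i, j)\<in>digit_pairs n. if P i then 1 else (0::int)) =
      (\<Sum>i\<in>{1..n}. \<Sum>j\<in>{1..<i}. if P i then 1 else 0)"
    unfolding digit_pairs_def by (rule sum.Sigma[symmetric]) auto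
  also have "\<dots> = (\<Sum>i\<in>{1..n}. if P i then int i - 1 else 0)"
    by (rule sum.cong) (auto simp: of_nat_diff)
  also have "\<dots> = (\<Sum>i\<in>{i \<in> {1..n}. P i}. int i - 1)"
    by (rule sum.inter_filter[symmetric]) simp
  finally show ?thesis ..
qed

lemma fibral_length_eq:
  assumes "\<pi> \<in> alt_colored r n"
  shows "fibral_length r n \<pi> =
    2 * (\<Sum>i\<in>{i \<in> {1..n}. digit_color \<pi> i = h}. int i - 1) - 2 * int (tinv r n \<pi>)"
proof -
  obtain z \<tau> where z\<tau>: "\<pi> = (z, \<tau>)"
    by force
  have \<pi>: "\<pi> \<in> carrier G" "even_colored n \<pi>"
    using assms by (auto simp: alt_colored_eq)
  then have z: "z \<in> {1..n} \<rightarrow>\<^sub>E {0..<r}"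
    by (simp add: z\<tau> colored_carrier_iff)
  let ?q = "inv' \<tau>"
  let ?y = "\<lambda>d\<in>{1..n}. ((if odd (inversion_number n \<tau>) \<and> d = 1 then h else 0) +
       2 * half_color r (z d)) mod r"
  have sec_eq: "covering_section r n (covering r n \<pi>) = (?y, \<tau>)"
    using section_covering \<pi>(1) unfolding z\<tau> by simp
  have "half_color r (?y d) = half_color r (z d)" if "d \<in> {1..n}" for d
    using that half_color_lt
    by (simp add: half_color_mod_r half_color_add_h half_color_double mod_less)
  then have colors: "(\<Sum>d\<in>{1..n}. half_color r (?y d)) = (\<Sum>d\<in>{1..n}. half_color r (z d))"
    by (rule sum.cong[OF refl])
  \<comment> \<open>Costs only see whether the color of \<open>i\<close> is zero. As
    \<open>i\<close> is not 1, the correction \<open>h\<close> is absent, and the section color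
    vanishes exactly for \<open>z i\<close> equal to 0 or \<open>h\<close>. Only
    \<open>z i = h\<close> makes a difference: 2 falls to 0 if \<open>j\<close> stands before
    \<open>i\<close>, and otherwise both costs are 1.\<close>
  have cost: "int (pair_cost z ?q i j) - int (pair_cost ?y ?q i j) =
      2 * (if z i = h then 1 else 0) - 2 * (if z i = h \<and> ?q i < ?q j then 1 else 0)"
    if "(i, j) \<in> digit_pairs n" for i j
  proof -
    have i: "i \<in> {1..n}" "i \<noteq> 1"
      using that by (auto simp: digit_pairs_def)
    then have "?y i = 0 \<longleftrightarrow> half_color r (z i) = 0"
      using half_color_lt[of "z i"] by (simp add: r_eq)
    moreover have "half_color r (z i) = 0 \<longleftrightarrow> z i = 0 \<or> z i = h"
      using PiE_mem[OF z i(1)] by (intro half_color_eq_0_iff) simp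
    ultimately show ?thesis
      using h_pos by (simp add: pair_cost_def)
  qed
  have "fibral_length r n \<pi> = int (len_formula r n (z, \<tau>)) - int (len_formula r n (?y, \<tau>))"
    unfolding fibral_length_def a_length_eq_len_formula[OF \<pi>]
      a_length_eq_len_formula[OF section_covering_in[OF \<pi>(1)]]
    unfolding sec_eq unfolding z\<tau> ..
  also have "\<dots> = int (\<Sum>(i, j)\<in>digit_pairs n. pair_cost z ?q i j) -
      int (\<Sum>(i, j)\<in>digit_pairs n. pair_cost ?y ?q i j)"
    unfolding len_formula_def fst_conv snd_conv colors by simp
  also have "\<dots> = (\<Sum>(i, j)\<in>digit_pairs n. int (pair_cost z ?q i j) - int (pair_cost ?y ?q i j))"
    by (simp add: sum_subtractf case_prod_unfold)
  also have "\<dots> = (\<Sum>(i, j)\<in>digit_pairs n.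
      2 * (if z i = h then 1 else 0) - 2 * (if z i = h \<and> ?q i < ?q j then 1 else 0))"
    by (rule sum.cong) (auto simp only: cost split: prod.split)
  also have "\<dots> = 2 * (\<Sum>(i, j)\<in>digit_pairs n. if z i = h then 1 else 0) -
      2 * (\<Sum>(i, j)\<in>digit_pairs n. if z i = h \<and> ?q i < ?q j then 1 else 0)"
    by (simp only: sum_subtractf sum_distrib_left case_prod_unfold)
  also have "\<dots> = 2 * (\<Sum>i\<in>{i \<in> {1..n}. digit_color \<pi> i = h}. int i - 1) - 2 * int (tinv r n \<pi>)"
  proof -
    have "int (tinv r n \<pi>) = (\<Sum>(i, j)\<in>digit_pairs n. if z i = h \<and> ?q i < ?q j then 1 else 0)"
      unfolding z\<tau> tinv_eq_sum of_nat_sum by (rule sum.cong) auto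
    moreover have "(\<Sum>i\<in>{i \<in> {1..n}. digit_color \<pi> i = h}. int i - 1) =
        (\<Sum>(i, j)\<in>digit_pairs n. if z i = h then 1 else 0)"
      unfolding z\<tau> digit_color_def fst_conv by (rule sum_digits_eq_sum_pairs)
    ultimately show ?thesis by simp
  qed
  finally show ?thesis .
qed

end

theorem theorem6p14:
  fixes r n :: nat and \<pi> :: colored_perm
  assumes "r > 0" and "n > 0" and "r mod 4 = 2"
    and "\<pi> \<in> alt_colored r n"
  shows "fibral_length r n \<pi> =
    2 * (\<Sum>i\<in>{i \<in> {1..n}. digit_color \<pi> i = r div 2}. int i - 1) - 2 * int (tinv r n \<pi>)"
proof -
  have "r = 2 * (r div 2)" "odd (r div 2)"
    using assms(3) by presburger+
  then interpret twice_odd r n "r div 2"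
    using assms(2) by unfold_locales
  show ?thesis
    using assms(4) by (rule fibral_length_eq)
qed

end
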